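(* Let $\kappa$ be an infinite cardinal and let $^*\mathbb{C}$ be $\kappa$-saturated. Then for every convex subring $\mathcal{M}$ of $^*\mathbb{C}$ the asymptotic field $\widehat{\mathcal{M}}$ is Cantor $\kappa$-complete. In particular, for every positive infinitesimal $\rho\in{}^*\mathbb{R}$, the asymptotic fields $\widehat{\mathcal{L}_\rho}$, $\widehat{\mathcal{F}_\rho}$, ${}^\rho\mathbb{C}=\widehat{\mathcal{M}_\rho}$ and $\widehat{\mathcal{E}_\rho}$ and their real parts are all Cantor $\kappa$-complete.
   Context: $^*\mathbb{R}$ denotes a nonstandard extension (ultrapower) of $\mathbb{R}$, $^*\mathbb{C}={}^*\mathbb{R}(i)$ with absolute value $|\cdot|:{}^*\mathbb{C}\to{}^*\mathbb{R}$. $^*\mathbb{C}$ is $\kappa$-saturated if every family of internal subsets of $^*\mathbb{C}$ with the finite intersection property, indexed by a set of cardinality at most $\kappa$, has non-empty intersection. Rings have an identity and subrings contain it. A subring $\mathcal{M}$ of $^*\mathbb{C}$ is convex if for all $z\in{}^*\mathbb{C}$, $\zeta\in\mathcal{M}$, $|z|\le|\zeta|$ implies $z\in\mathcal{M}$. $\mathcal{M}_0=\{z\in\mathcal{M}: z=0\text{ or }1/z\notin\mathcal{M}\}$ is the maximal ideal of $\mathcal{M}$, $\widehat{\mathcal{M}}=\mathcal{M}/\mathcal{M}_0$ is the asymptotic field generated by $\mathcal{M}$, and its real part is the image $\mathbb{K}$ of ${}^*\mathbb{R}\cap\mathcal{M}$ under the quotient map $z\mapsto\widehat z$, totally ordered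 by: $\widehat{x}>0$ iff $\widehat{x}\neq0$ and $x>0$ in $^*\mathbb{R}$; one has $\widehat{\mathcal{M}}=\mathbb{K}(i)$. An ordered field $\mathbb{K}$ is Cantor $\kappa$-complete if every collection of fewer than $\kappa$ closed intervals $[a,b]$ of $\mathbb{K}$ with the finite intersection property has non-empty intersection; $\mathbb{K}(i)$ is called Cantor $\kappa$-complete if $\mathbb{K}$ is. For a positive infinitesimal $\rho$: $\mathcal{L}_\rho=\{z\in{}^*\mathbb{C}:|z|<\log_n(1/\rho)\ \forall n\in\mathbb{N}\}$, with $\log_n$ the $n$-fold iterate of $^*\ln$; $\mathcal{F}_\rho=\{z:|z|<1/\sqrt[n]{\rho}\ \forall n\in\mathbb{N}\}$; $\mathcal{M}_\rho=\{z:|z|\le\rho^{-n}\text{ for some }n\in\mathbb{N}\}$; $\mathcal{E}_\rho=\{z:|z|\le\exp_n(1/\rho)\text{ for some }n\in\mathbb{N}\}$, with $\exp_n$ the $n$-fold iterate of the exponential. These are convex subrings of $^*\mathbb{C}$. *)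

theory Defs
  imports Complex_Main "HOL-Algebra.QuotRing" "HOL-Algebra.Generated_Fields"
begin

unbundle cardinal_syntax

section \<open>Ultrapowers\<close>

definition ultrafilter :: "'i filter \<Rightarrow> bool" where
  "ultrafilter U \<longleftrightarrow> U \<noteq> bot \<and> (\<forall>P. eventually P U \<or> eventually (\<lambda>i. \<not> P i) U)"

definition star_class :: "'i filter \<Rightarrow> ('i \<Rightarrow> 'a) \<Rightarrow> ('i \<Rightarrow> 'a) set" where
  "star_class U f = {g. \<forall>\<^sub>F i in U. g i = f i}"

definition ultrapower :: "'i filter \<Rightarrow> ('i \<Rightarrow> 'a) set set" where
  "ultrapower U = range (star_class U)"

definition star_map :: "'i filter \<Rightarrow> ('a \<Rightarrow> 'b) \<Rightarrow> ('i \<Rightarrow> 'a) set \<Rightarrow> ('i \<Rightarrow> 'b) set" where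
  "star_map U F S = {h. \<exists>f\<in>S. \<forall>\<^sub>F i in U. h i = F (f i)}"

definition star_map2 ::
  "'i filter \<Rightarrow> ('a \<Rightarrow> 'b \<Rightarrow> 'c) \<Rightarrow> ('i \<Rightarrow> 'a) set \<Rightarrow> ('i \<Rightarrow> 'b) set \<Rightarrow> ('i \<Rightarrow> 'c) set" where
  "star_map2 U F S T = {h. \<exists>f\<in>S. \<exists>g\<in>T. \<forall>\<^sub>F i in U. h i = F (f i) (g i)}"

definition star_rel ::
  "'i filter \<Rightarrow> ('a \<Rightarrow> 'b \<Rightarrow> bool) \<Rightarrow> ('i \<Rightarrow> 'a) set \<Rightarrow> ('i \<Rightarrow> 'b) set \<Rightarrow> bool" where
  "star_rel U R S T \<longleftrightarrow> (\<exists>f\<in>S. \<exists>g\<in>T. \<forall>\<^sub>F i in U. R (f i) (g i))"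

definition internal_set :: "'i filter \<Rightarrow> ('i \<Rightarrow> 'a) set set \<Rightarrow> bool" where
  "internal_set U S \<longleftrightarrow> (\<exists>A. S = {star_class U f | f. \<forall>\<^sub>F i in U. f i \<in> A i})"


section \<open>The nonstandard real and complex numbers\<close>

type_synonym 'i hreal = "('i \<Rightarrow> real) set"
type_synonym 'i hcomplex = "('i \<Rightarrow> complex) set"

definition HR :: "'i filter \<Rightarrow> 'i hreal set" where
  "HR U = ultrapower U"

text \<open>
  The ultrapower of the complex numbers is the field obtained from the ultrapower of the
  reals by adjoining a square root of \<open>-1\<close>, namely the class of the constant family \<open>\<i>\<close>.
\<close>

definition HC :: "'i filter \<Rightarrow> 'i hcomplex ring" where
  "HC U = \<lparr>carrier = ultrapower U, mult = star_map2 U (*), one = star_class U (\<lambda>_. 1),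
           zero = star_class U (\<lambda>_. 0), add = star_map2 U (+)\<rparr>"

abbreviation hless :: "'i filter \<Rightarrow> 'i hreal \<Rightarrow> 'i hreal \<Rightarrow> bool" where
  "hless U \<equiv> star_rel U (<)"

abbreviation hle :: "'i filter \<Rightarrow> 'i hreal \<Rightarrow> 'i hreal \<Rightarrow> bool" where
  "hle U \<equiv> star_rel U (\<le>)"

abbreviation hconst :: "'i filter \<Rightarrow> real \<Rightarrow> 'i hreal" where
  "hconst U r \<equiv> star_class U (\<lambda>_. r)"

abbreviation hcmod :: "'i filter \<Rightarrow> 'i hcomplex \<Rightarrow> 'i hreal" where
  "hcmod U \<equiv> star_map U cmod"

abbreviation hcomplex_of_hreal :: "'i filter \<Rightarrow> 'i hreal \<Rightarrow> 'i hcomplex" where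
  "hcomplex_of_hreal U \<equiv> star_map U complex_of_real"

text \<open>
  A family of internal sets is given by its range. For infinite \<open>\<kappa>\<close>, saturation forces \<open>U\<close> to
  be free, so that the extension is proper.
\<close>

definition saturated :: "'k rel \<Rightarrow> 'i filter \<Rightarrow> bool" where
  "saturated \<kappa> U \<longleftrightarrow>
     (\<forall>\<A> :: 'i hcomplex set set.
        (\<forall>A\<in>\<A>. internal_set U A) \<and> |\<A>| \<le>o \<kappa> \<and>
        (\<forall>\<B>\<subseteq>\<A>. finite \<B> \<longrightarrow> (\<exists>z\<in>carrier (HC U). \<forall>B\<in>\<B>. z \<in> B)) \<longrightarrow>
        (\<exists>z\<in>carrier (HC U). \<forall>A\<in>\<A>. z \<in> A))"

definition pos_infinitesimal :: "'i filter \<Rightarrow> 'i hreal \<Rightarrow> bool" where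
  "pos_infinitesimal U \<rho> \<longleftrightarrow> \<rho> \<in> HR U \<and> hless U (hconst U 0) \<rho> \<and>
     (\<forall>n::nat. n \<ge> 1 \<longrightarrow> hless U \<rho> (hconst U (1 / real n)))"


section \<open>Asymptotic fields\<close>

definition convex_subring :: "'i filter \<Rightarrow> 'i hcomplex set \<Rightarrow> bool" where
  "convex_subring U M \<longleftrightarrow> subring M (HC U) \<and>
     (\<forall>z\<in>carrier (HC U). \<forall>\<zeta>\<in>M. hle U (hcmod U z) (hcmod U \<zeta>) \<longrightarrow> z \<in> M)"

definition max_ideal :: "'i filter \<Rightarrow> 'i hcomplex set \<Rightarrow> 'i hcomplex set" where
  "max_ideal U M = {z \<in> M. z = \<zero>\<^bsub>HC U\<^esub> \<or> inv\<^bsub>HC U\<^esub> z \<notin> M}"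

definition asymptotic_field :: "'i filter \<Rightarrow> 'i hcomplex set \<Rightarrow> 'i hcomplex set ring" where
  "asymptotic_field U M = (HC U\<lparr>carrier := M\<rparr>) Quot (max_ideal U M)"

definition hat :: "'i filter \<Rightarrow> 'i hcomplex set \<Rightarrow> 'i hcomplex \<Rightarrow> 'i hcomplex set" where
  "hat U M z = max_ideal U M +>\<^bsub>HC U\<lparr>carrier := M\<rparr>\<^esub> z"

definition real_part :: "'i filter \<Rightarrow> 'i hcomplex set \<Rightarrow> 'i hcomplex set ring" where
  "real_part U M = asymptotic_field U M
     \<lparr>carrier := hat U M ` (hcomplex_of_hreal U ` HR U \<inter> M)\<rparr>"

definition real_part_pos :: "'i filter \<Rightarrow> 'i hcomplex set \<Rightarrow> 'i hcomplex set set" where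
  "real_part_pos U M = {hat U M (hcomplex_of_hreal U x) | x.
     x \<in> HR U \<and> hcomplex_of_hreal U x \<in> M \<and>
     hat U M (hcomplex_of_hreal U x) \<noteq> \<zero>\<^bsub>asymptotic_field U M\<^esub> \<and>
     hless U (hconst U 0) x}"


section \<open>Cantor completeness\<close>

text \<open>
  An ordered field is given by a field \<open>K\<close> and its set \<open>P\<close> of positive elements.
\<close>

definition ordered_field :: "('a, 'b) ring_scheme \<Rightarrow> 'a set \<Rightarrow> bool" where
  "ordered_field K P \<longleftrightarrow> field K \<and> P \<subseteq> carrier K \<and> \<zero>\<^bsub>K\<^esub> \<notin> P \<and>
     (\<forall>x\<in>P. \<forall>y\<in>P. x \<oplus>\<^bsub>K\<^esub> y \<in> P \<and> x \<otimes>\<^bsub>K\<^esub> y \<in> P) \<and>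
     (\<forall>x\<in>carrier K. x = \<zero>\<^bsub>K\<^esub> \<or> x \<in> P \<or> \<ominus>\<^bsub>K\<^esub> x \<in> P)"

definition of_le :: "('a, 'b) ring_scheme \<Rightarrow> 'a set \<Rightarrow> 'a \<Rightarrow> 'a \<Rightarrow> bool" where
  "of_le K P x y \<longleftrightarrow> x = y \<or> y \<ominus>\<^bsub>K\<^esub> x \<in> P"

definition of_interval :: "('a, 'b) ring_scheme \<Rightarrow> 'a set \<Rightarrow> 'a \<Rightarrow> 'a \<Rightarrow> 'a set" where
  "of_interval K P a b = {x \<in> carrier K. of_le K P a x \<and> of_le K P x b}"

definition cantor_complete :: "'k rel \<Rightarrow> ('a, 'b) ring_scheme \<Rightarrow> 'a set \<Rightarrow> bool" where
  "cantor_complete \<kappa> K P \<longleftrightarrow> ordered_field K P \<and>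
     (\<forall>\<C>. (\<forall>C\<in>\<C>. \<exists>a\<in>carrier K. \<exists>b\<in>carrier K. C = of_interval K P a b) \<and> |\<C>| <o \<kappa> \<and>
        (\<forall>\<D>\<subseteq>\<C>. finite \<D> \<longrightarrow> (\<exists>x\<in>carrier K. \<forall>D\<in>\<D>. x \<in> D)) \<longrightarrow>
        (\<exists>x\<in>carrier K. \<forall>C\<in>\<C>. x \<in> C))"

text \<open>\<open>L = K(i)\<close> for a subfield \<open>K\<close> of \<open>L\<close> and a square root \<open>i\<close> of \<open>-1\<close> in \<open>L\<close>.\<close>

definition adjoin_i :: "('a, 'b) ring_scheme \<Rightarrow> 'a set \<Rightarrow> bool" where
  "adjoin_i L K \<longleftrightarrow> field L \<and> subfield K L \<and>
     (\<exists>i\<in>carrier L. i \<otimes>\<^bsub>L\<^esub> i = \<ominus>\<^bsub>L\<^esub> \<one>\<^bsub>L\<^esub> \<and> carrier L = generate_field L (insert i K))"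

text \<open>Cantor completeness of the field \<open>L = K(i)\<close>, where \<open>P\<close> is the set of positive elements
  of the ordered field \<open>K\<close>.\<close>

definition cantor_complete_adjoin_i ::
  "'k rel \<Rightarrow> ('a, 'b) ring_scheme \<Rightarrow> 'a set \<Rightarrow> 'a set \<Rightarrow> bool" where
  "cantor_complete_adjoin_i \<kappa> L K P \<longleftrightarrow>
     adjoin_i L K \<and> cantor_complete \<kappa> (L\<lparr>carrier := K\<rparr>) P"

definition asymptotic_field_complete :: "'k rel \<Rightarrow> 'i filter \<Rightarrow> 'i hcomplex set \<Rightarrow> bool" where
  "asymptotic_field_complete \<kappa> U M \<longleftrightarrow>
     cantor_complete_adjoin_i \<kappa> (asymptotic_field U M) (carrier (real_part U M)) (real_part_pos U M)"

definition real_part_complete :: "'k rel \<Rightarrow> 'i filter \<Rightarrow> 'i hcomplex set \<Rightarrow> bool" where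
  "real_part_complete \<kappa> U M \<longleftrightarrow> cantor_complete \<kappa> (real_part U M) (real_part_pos U M)"


section \<open>The rings of the four scales\<close>

text \<open>The natural numbers here start at \<open>1\<close>: the \<open>0\<close>-th root is meaningless (it is the zero
  function in the library), and the other three rings do not change if \<open>n = 0\<close> is included.\<close>

definition L_ring :: "'i filter \<Rightarrow> 'i hreal \<Rightarrow> 'i hcomplex set" where
  "L_ring U \<rho> = {z \<in> carrier (HC U). \<forall>n\<ge>1.
     hless U (hcmod U z) ((star_map U (ln :: real \<Rightarrow> real) ^^ n) (star_map U (\<lambda>x. 1 / x) \<rho>))}"

definition F_ring :: "'i filter \<Rightarrow> 'i hreal \<Rightarrow> 'i hcomplex set" where
  "F_ring U \<rho> = {z \<in> carrier (HC U). \<forall>n\<ge>1.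
     hless U (hcmod U z) (star_map U (\<lambda>x. 1 / root n x) \<rho>)}"

definition M_ring :: "'i filter \<Rightarrow> 'i hreal \<Rightarrow> 'i hcomplex set" where
  "M_ring U \<rho> = {z \<in> carrier (HC U). \<exists>n\<ge>1.
     hle U (hcmod U z) (star_map U (\<lambda>x. x powi (- int n)) \<rho>)}"

definition E_ring :: "'i filter \<Rightarrow> 'i hreal \<Rightarrow> 'i hcomplex set" where
  "E_ring U \<rho> = {z \<in> carrier (HC U). \<exists>n\<ge>1.
     hle U (hcmod U z) ((star_map U (exp :: real \<Rightarrow> real) ^^ n) (star_map U (\<lambda>x. 1 / x) \<rho>))}"

end

theory Submission
  imports Defs
begin

text \<open>
  Representatives of the endpoints of a family of closed intervals of the real part give a family
  of closed intervals of the nonstandard reals. If the left endpoint of one interval equals the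
  right endpoint of another, that point is common to all of them. Otherwise the
  finite intersection property makes all inequalities between endpoints strict, so it passes to
  the intervals between representatives whatever representatives are chosen. These intervals are
  internal; a point common to all of them exists by saturation, belongs to the ring by convexity,
  and its residue class lies in all the given intervals.
\<close>

section \<open>Arithmetic of classes\<close>

text \<open>Passing to residues coarsens the order: when two residues coincide, their
  representatives may stand in either order, as long as they differ by an element of the maximal
  ideal. That ideal need not be internal, so widening the intervals by it would in general leave the
  range of saturation. Convexity of the ideal is what makes a strict inequality between residues
  hold for every choice of representatives; hence the separate treatment of coinciding endpoints.
  For the four rings, convexity is visible from their bounds. The real content is closure under sums
  and products, which is a growth comparison between members of the scale of bounds.\<close>

locale ultra =
  fixes U :: "'i filter"
  assumes ultrafilter: "ultrafilter U"
begin

lemma nontrivial: "U \<noteq> bot"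
  using ultrafilter by (simp add: ultrafilter_def)

text \<open>This is where maximality of the filter enters: a negated statement about classes becomes
  an eventual statement about representatives, which can then be combined pointwise with
  others.\<close>

lemma not_eventually_iff: "\<not> eventually P U \<longleftrightarrow> (\<forall>\<^sub>F i in U. \<not> P i)"
proof -
  have "\<not> (eventually P U \<and> (\<forall>\<^sub>F i in U. \<not> P i))"
    using nontrivial by (auto simp flip: eventually_conj_iff)
  then show ?thesis
    using ultrafilter unfolding ultrafilter_def by blast
qed

lemma star_class_eq_iff: "star_class U f = star_class U g \<longleftrightarrow> (\<forall>\<^sub>F i in U. f i = g i)"
proof
  assume "star_class U f = star_class U g"
  moreover have "f \<in> star_class U f"
    by (simp add: star_class_def)
  ultimately show "\<forall>\<^sub>F i in U. f i = g i"
    by (simp add: star_class_def)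
next
  assume eq: "\<forall>\<^sub>F i in U. f i = g i"
  have "(\<forall>\<^sub>F i in U. k i = f i) \<longleftrightarrow> (\<forall>\<^sub>F i in U. k i = g i)" for k
    using eq by (auto elim: eventually_elim2)
  then show "star_class U f = star_class U g"
    by (simp add: star_class_def)
qed

lemma star_map_star_class: "star_map U F (star_class U f) = star_class U (\<lambda>i. F (f i))"
proof -
  have "(\<exists>f'. (\<forall>\<^sub>F i in U. f' i = f i) \<and> (\<forall>\<^sub>F i in U. k i = F (f' i)))
      \<longleftrightarrow> (\<forall>\<^sub>F i in U. k i = F (f i))" for k
  proof
    assume "\<exists>f'. (\<forall>\<^sub>F i in U. f' i = f i) \<and> (\<forall>\<^sub>F i in U. k i = F (f' i))"
    then show "\<forall>\<^sub>F i in U. k i = F (f i)"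
      by (auto elim: eventually_elim2)
  qed (auto intro!: exI[of _ f])
  then show ?thesis
    by (simp add: star_map_def star_class_def)
qed

lemma star_map2_star_class:
  "star_map2 U F (star_class U f) (star_class U g) = star_class U (\<lambda>i. F (f i) (g i))"
proof -
  have "(\<exists>f'. (\<forall>\<^sub>F i in U. f' i = f i) \<and>
            (\<exists>g'. (\<forall>\<^sub>F i in U. g' i = g i) \<and> (\<forall>\<^sub>F i in U. k i = F (f' i) (g' i))))
      \<longleftrightarrow> (\<forall>\<^sub>F i in U. k i = F (f i) (g i))" (is "?L k \<longleftrightarrow> ?R k") for k
  proof
    assume "?L k"
    then obtain f' g' where "\<forall>\<^sub>F i in U. f' i = f i" "\<forall>\<^sub>F i in U. g' i = g i"
        "\<forall>\<^sub>F i in U. k i = F (f' i) (g' i)"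
      by blast
    then show "?R k"
      by eventually_elim simp
  next
    assume "?R k"
    then show "?L k"
      by (intro exI[of _ f] conjI exI[of _ g]) simp_all
  qed
  then show ?thesis
    by (simp add: star_map2_def star_class_def)
qed

lemma star_rel_star_class:
  "star_rel U R (star_class U f) (star_class U g) \<longleftrightarrow> (\<forall>\<^sub>F i in U. R (f i) (g i))"
proof
  assume "star_rel U R (star_class U f) (star_class U g)"
  then obtain f' g' where "\<forall>\<^sub>F i in U. f' i = f i" "\<forall>\<^sub>F i in U. g' i = g i"
      "\<forall>\<^sub>F i in U. R (f' i) (g' i)"
    by (auto simp: star_rel_def star_class_def)
  then show "\<forall>\<^sub>F i in U. R (f i) (g i)"
    by eventually_elim simp
next
  assume "\<forall>\<^sub>F i in U. R (f i) (g i)"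
  moreover have "f \<in> star_class U f" "g \<in> star_class U g"
    by (simp_all add: star_class_def)
  ultimately show "star_rel U R (star_class U f) (star_class U g)"
    by (auto simp: star_rel_def)
qed

lemma carrier_HC: "carrier (HC U) = range (star_class U)"
  by (simp add: HC_def ultrapower_def)

lemma zero_HC: "\<zero>\<^bsub>HC U\<^esub> = star_class U (\<lambda>_. 0)"
  and one_HC: "\<one>\<^bsub>HC U\<^esub> = star_class U (\<lambda>_. 1)"
  by (simp_all add: HC_def)

lemma add_HC: "star_class U f \<oplus>\<^bsub>HC U\<^esub> star_class U g = star_class U (\<lambda>i. f i + g i)"
  and mult_HC: "star_class U f \<otimes>\<^bsub>HC U\<^esub> star_class U g = star_class U (\<lambda>i. f i * g i)"
  by (simp_all add: HC_def star_map2_star_class)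

lemmas star_class_simps = star_class_eq_iff star_map_star_class star_map2_star_class
  star_rel_star_class carrier_HC zero_HC one_HC add_HC mult_HC

lemma field_HC: "field (HC U)"
proof -
  have "abelian_group (HC U)"
  proof (rule abelian_groupI)
    fix x assume "x \<in> carrier (HC U)"
    then obtain f where "x = star_class U f"
      by (auto simp: carrier_HC)
    then show "\<exists>y\<in>carrier (HC U). y \<oplus>\<^bsub>HC U\<^esub> x = \<zero>\<^bsub>HC U\<^esub>"
      by (intro bexI[of _ "star_class U (\<lambda>i. - f i)"]) (auto simp: star_class_simps)
  qed (auto simp: star_class_simps algebra_simps)
  moreover have "Group.comm_monoid (HC U)"
    by (rule comm_monoidI) (auto simp: star_class_simps algebra_simps)
  ultimately interpret cring "HC U"
    by (rule cringI) (auto simp: star_class_simps algebra_simps)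
  show ?thesis
  proof (rule cring_fieldI2)
    show "\<zero>\<^bsub>HC U\<^esub> \<noteq> \<one>\<^bsub>HC U\<^esub>"
      using nontrivial by (simp add: star_class_simps)
  next
    fix x assume "x \<in> carrier (HC U)" and nz: "x \<noteq> \<zero>\<^bsub>HC U\<^esub>"
    then obtain f where f: "x = star_class U f"
      by (auto simp: carrier_HC)
    \<comment> \<open>A nonzero class is a priori only not eventually zero; the ultrafilter turns
      this into eventually nonzero. The value \<open>inverse 0 = 0\<close> at the exceptional
      indices is harmless.\<close>
    have "\<forall>\<^sub>F i in U. f i \<noteq> 0"
      using nz by (simp add: f star_class_simps not_eventually_iff)
    then have "\<forall>\<^sub>F i in U. f i * inverse (f i) = 1"
      by eventually_elim simp
    then show "\<exists>y\<in>carrier (HC U). x \<otimes>\<^bsub>HC U\<^esub> y = \<one>\<^bsub>HC U\<^esub>"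
      by (intro bexI[of _ "star_class U (\<lambda>i. inverse (f i))"]) (auto simp: f star_class_simps)
  qed
qed

sublocale HC: field "HC U"
  by (rule field_HC)

lemma a_inv_HC: "\<ominus>\<^bsub>HC U\<^esub> star_class U f = star_class U (\<lambda>i. - f i)"
  by (rule HC.minus_equality) (auto simp: star_class_simps)

lemma m_inv_HC:
  assumes "\<forall>\<^sub>F i in U. f i \<noteq> 0"
  shows "inv\<^bsub>HC U\<^esub> star_class U f = star_class U (\<lambda>i. inverse (f i))"
proof (rule HC.comm_inv_char)
  show "star_class U f \<otimes>\<^bsub>HC U\<^esub> star_class U (\<lambda>i. inverse (f i)) = \<one>\<^bsub>HC U\<^esub>"
    using assms by (auto simp: star_class_simps elim: eventually_mono)
qed (auto simp: carrier_HC)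

text \<open>Closure under negation is supplied by convexity, since \<open>- f\<close> and
  \<open>f\<close> have the same absolute value.\<close>

lemma convex_subringI:
  assumes carrier: "M \<subseteq> carrier (HC U)"
    and one: "star_class U (\<lambda>_. 1) \<in> M"
    and add: "\<And>f g. star_class U f \<in> M \<Longrightarrow> star_class U g \<in> M \<Longrightarrow> star_class U (\<lambda>i. f i + g i) \<in> M"
    and mult: "\<And>f g. star_class U f \<in> M \<Longrightarrow> star_class U g \<in> M \<Longrightarrow> star_class U (\<lambda>i. f i * g i) \<in> M"
    and convex: "\<And>f g. star_class U g \<in> M \<Longrightarrow> \<forall>\<^sub>F i in U. cmod (f i) \<le> cmod (g i) \<Longrightarrow>
      star_class U f \<in> M"
  shows "convex_subring U M"
  unfolding convex_subring_def
proof (intro conjI ballI impI HC.subringI)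
  fix x y assume xy: "x \<in> M" "y \<in> M"
  then obtain f g where fg: "x = star_class U f" "y = star_class U g"
    using carrier unfolding carrier_HC by blast
  show "x \<otimes>\<^bsub>HC U\<^esub> y \<in> M" "x \<oplus>\<^bsub>HC U\<^esub> y \<in> M"
    using xy add mult by (simp_all add: fg add_HC mult_HC)
  show "\<ominus>\<^bsub>HC U\<^esub> x \<in> M"
    using xy convex[of f "\<lambda>i. - f i"] by (simp add: fg a_inv_HC)
next
  fix z \<zeta> assume "z \<in> carrier (HC U)" "\<zeta> \<in> M" "hle U (hcmod U z) (hcmod U \<zeta>)"
  then show "z \<in> M"
    using carrier convex by (auto simp: star_class_simps)
qed (use carrier one in \<open>auto simp: one_HC\<close>)

end


section \<open>The asymptotic field\<close>

locale convex_ultra = ultra U for U :: "'i filter" +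
  fixes M :: "'i hcomplex set"
  assumes convex_subring: "convex_subring U M"
begin

lemma subring_M: "subring M (HC U)"
  using convex_subring by (simp add: convex_subring_def)

lemma M_subset: "M \<subseteq> range (star_class U)"
  using subringE(1)[OF subring_M] by (simp add: carrier_HC)

lemma M_convex:
  assumes "star_class U g \<in> M" "\<forall>\<^sub>F i in U. cmod (f i) \<le> cmod (g i)"
  shows "star_class U f \<in> M"
proof -
  have "hle U (hcmod U (star_class U f)) (hcmod U (star_class U g))"
    using assms(2) by (simp add: star_class_simps)
  with assms(1) show ?thesis
    using convex_subring by (auto simp: convex_subring_def carrier_HC)
qed

lemma M_one: "star_class U (\<lambda>_. 1) \<in> M"
  using subringE(3)[OF subring_M] by (simp add: one_HC)

lemma M_zero: "star_class U (\<lambda>_. 0) \<in> M"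
  using subringE(2)[OF subring_M] by (simp add: zero_HC)

lemma M_add: "star_class U f \<in> M \<Longrightarrow> star_class U g \<in> M \<Longrightarrow> star_class U (\<lambda>i. f i + g i) \<in> M"
  using subringE(7)[OF subring_M] by (metis add_HC)

lemma M_mult: "star_class U f \<in> M \<Longrightarrow> star_class U g \<in> M \<Longrightarrow> star_class U (\<lambda>i. f i * g i) \<in> M"
  using subringE(6)[OF subring_M] by (metis mult_HC)

lemma M_minus: "star_class U f \<in> M \<Longrightarrow> star_class U (\<lambda>i. - f i) \<in> M"
  using subringE(5)[OF subring_M] by (metis a_inv_HC)

lemma M_diff: "star_class U f \<in> M \<Longrightarrow> star_class U g \<in> M \<Longrightarrow> star_class U (\<lambda>i. f i - g i) \<in> M"
  using M_add[OF _ M_minus, of f g] by simp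

text \<open>A description of the ideal free of inverses, from which its closure properties follow by
  pointwise estimates. If \<open>f * g\<close> has absolute value at least 1, then
  \<open>inverse f\<close> is bounded by \<open>g\<close> and lies in \<open>M\<close> by convexity.
  Conversely, the choice \<open>g = 1\<close> puts \<open>f\<close> into \<open>M\<close>, and
  \<open>g = inverse f\<close> would give the product 1.\<close>

lemma max_ideal_iff:
  "star_class U f \<in> max_ideal U M \<longleftrightarrow>
     (\<forall>g. star_class U g \<in> M \<longrightarrow> (\<forall>\<^sub>F i in U. cmod (f i * g i) < 1))"
proof
  assume L: "star_class U f \<in> max_ideal U M"
  show "\<forall>g. star_class U g \<in> M \<longrightarrow> (\<forall>\<^sub>F i in U. cmod (f i * g i) < 1)"
  proof (intro allI impI, rule ccontr)
    fix g assume g: "star_class U g \<in> M" and "\<not> (\<forall>\<^sub>F i in U. cmod (f i * g i) < 1)"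
    then have ge: "\<forall>\<^sub>F i in U. 1 \<le> cmod (f i * g i)"
      by (simp add: not_eventually_iff not_less)
    then have nz: "\<forall>\<^sub>F i in U. f i \<noteq> 0"
      by eventually_elim auto
    then have "star_class U f \<noteq> \<zero>\<^bsub>HC U\<^esub>"
      by (simp add: star_class_simps not_eventually_iff)
    with L nz have "star_class U (\<lambda>i. inverse (f i)) \<notin> M"
      by (auto simp: max_ideal_def m_inv_HC)
    moreover have "star_class U (\<lambda>i. inverse (f i)) \<in> M"
      using g
    proof (rule M_convex)
      show "\<forall>\<^sub>F i in U. cmod (inverse (f i)) \<le> cmod (g i)"
        using ge nz by eventually_elim (simp add: norm_mult norm_divide divide_simps mult.commute)
    qed
    ultimately show False
      by contradiction
  qed
next
  assume R: "\<forall>g. star_class U g \<in> M \<longrightarrow> (\<forall>\<^sub>F i in U. cmod (f i * g i) < 1)"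
  have "\<forall>\<^sub>F i in U. cmod (f i * 1) < 1"
    using R M_one by blast
  then have "\<forall>\<^sub>F i in U. cmod (f i) \<le> cmod 1"
    by eventually_elim simp
  with M_one have M: "star_class U f \<in> M"
    by (rule M_convex)
  have "inv\<^bsub>HC U\<^esub> star_class U f \<notin> M" if "star_class U f \<noteq> \<zero>\<^bsub>HC U\<^esub>"
  proof
    assume "inv\<^bsub>HC U\<^esub> star_class U f \<in> M"
    moreover have nz: "\<forall>\<^sub>F i in U. f i \<noteq> 0"
      using that by (simp add: star_class_simps not_eventually_iff)
    ultimately have "star_class U (\<lambda>i. inverse (f i)) \<in> M"
      by (simp add: m_inv_HC)
    then have "\<forall>\<^sub>F i in U. cmod (f i * inverse (f i)) < 1"
      using R by blast
    with nz have "\<forall>\<^sub>F i in U. False"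
      by eventually_elim simp
    then show False
      using nontrivial by simp
  qed
  with M show "star_class U f \<in> max_ideal U M"
    by (auto simp: max_ideal_def)
qed

lemma max_ideal_subset: "max_ideal U M \<subseteq> M"
  by (auto simp: max_ideal_def)

lemma max_ideal_convex:
  assumes "star_class U g \<in> max_ideal U M" "\<forall>\<^sub>F i in U. cmod (f i) \<le> cmod (g i)"
  shows "star_class U f \<in> max_ideal U M"
  unfolding max_ideal_iff
proof (intro allI impI)
  fix k assume "star_class U k \<in> M"
  then have "\<forall>\<^sub>F i in U. cmod (g i * k i) < 1"
    using assms(1) by (simp add: max_ideal_iff)
  with assms(2) show "\<forall>\<^sub>F i in U. cmod (f i * k i) < 1"
    by eventually_elim (auto simp: norm_mult intro: le_less_trans[OF mult_right_mono])
qed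

lemma max_ideal_add:
  assumes "star_class U f \<in> max_ideal U M" "star_class U g \<in> max_ideal U M"
  shows "star_class U (\<lambda>i. f i + g i) \<in> max_ideal U M"
  unfolding max_ideal_iff
proof (intro allI impI)
  fix k assume "star_class U k \<in> M"
  \<comment> \<open>Testing against \<open>2 * k\<close> instead of \<open>k\<close> makes each of
    the two summands smaller than 1/2.\<close>
  then have "star_class U (\<lambda>i. k i + k i) \<in> M"
    by (intro M_add)
  then have "\<forall>\<^sub>F i in U. cmod (f i * (k i + k i)) < 1" "\<forall>\<^sub>F i in U. cmod (g i * (k i + k i)) < 1"
    using assms by (simp_all add: max_ideal_iff)
  then show "\<forall>\<^sub>F i in U. cmod ((f i + g i) * k i) < 1"
  proof eventually_elim
    case (elim i)
    have "2 * cmod ((f i + g i) * k i) = cmod (f i * (k i + k i) + g i * (k i + k i))"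
      by (simp add: norm_mult flip: distrib_right mult_2)
    also have "\<dots> \<le> cmod (f i * (k i + k i)) + cmod (g i * (k i + k i))"
      by (rule norm_triangle_ineq)
    finally show ?case
      using elim by simp
  qed
qed

lemma max_ideal_mult:
  assumes "star_class U f \<in> max_ideal U M" "star_class U g \<in> M"
  shows "star_class U (\<lambda>i. f i * g i) \<in> max_ideal U M"
  unfolding max_ideal_iff
proof (intro allI impI)
  fix k assume "star_class U k \<in> M"
  then have "star_class U (\<lambda>i. g i * k i) \<in> M"
    using assms(2) by (intro M_mult)
  then show "\<forall>\<^sub>F i in U. cmod (f i * g i * k i) < 1"
    using assms(1) by (simp add: max_ideal_iff mult.assoc)
qed

lemma max_ideal_minus:
  "star_class U f \<in> max_ideal U M \<Longrightarrow> star_class U (\<lambda>i. - f i) \<in> max_ideal U M"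
  by (erule max_ideal_convex) simp

lemma zero_in_max_ideal: "star_class U (\<lambda>_. 0) \<in> max_ideal U M"
  by (simp add: max_ideal_iff)

lemma one_notin_max_ideal: "star_class U (\<lambda>_. 1) \<notin> max_ideal U M"
  using nontrivial M_one by (auto simp: max_ideal_iff dest!: spec[of _ "\<lambda>_. 1"])

section \<open>The quotient by the maximal ideal and its residue map\<close>

abbreviation R :: "'i hcomplex ring" where
  "R \<equiv> HC U\<lparr>carrier := M\<rparr>"

abbreviation L :: "'i hcomplex set ring" where
  "L \<equiv> asymptotic_field U M"

sublocale R: cring R
proof -
  have "M \<subseteq> carrier (HC U)"
    using subring_M by (rule subringE)
  with subring_M show "cring R"
    by (auto intro!: HC.subcring_iff[THEN iffD1] HC.subcringI simp: HC.m_comm subsetD)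
qed

text \<open>The additive inverse is a definite description over the carrier, so it does not carry
  over to a smaller carrier by unfolding; uniqueness of inverses in \<open>R\<close> determines it
  anew.\<close>

lemma a_inv_R: "star_class U f \<in> M \<Longrightarrow> \<ominus>\<^bsub>R\<^esub> star_class U f = star_class U (\<lambda>i. - f i)"
  by (rule R.minus_equality) (simp_all add: M_minus star_class_simps)

lemma minus_R: "star_class U f \<in> M \<Longrightarrow> star_class U g \<in> M \<Longrightarrow>
    star_class U f \<ominus>\<^bsub>R\<^esub> star_class U g = star_class U (\<lambda>i. f i - g i)"
  by (simp add: a_minus_def a_inv_R add_HC)

lemma ideal_max_ideal: "ideal (max_ideal U M) R"
proof (rule idealI)
  show "subgroup (max_ideal U M) (add_monoid R)"
  proof (rule R.add.subgroupI)
    fix x y assume "x \<in> max_ideal U M" "y \<in> max_ideal U M"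
    moreover from this obtain f g where "x = star_class U f" "y = star_class U g"
      using M_subset max_ideal_subset by blast
    ultimately show "x \<oplus>\<^bsub>R\<^esub> y \<in> max_ideal U M"
      by (simp add: add_HC max_ideal_add)
  next
    fix x assume x: "x \<in> max_ideal U M"
    then obtain f where "x = star_class U f"
      using M_subset max_ideal_subset by blast
    with x max_ideal_subset show "\<ominus>\<^bsub>R\<^esub> x \<in> max_ideal U M"
      by (auto simp: a_inv_R max_ideal_minus subsetD)
  qed (use zero_in_max_ideal max_ideal_subset in auto)
next
  fix a x assume ax: "a \<in> max_ideal U M" and "x \<in> carrier R"
  then have x: "x \<in> M"
    by simp
  then obtain f g where fg: "a = star_class U f" "x = star_class U g"
    using ax M_subset max_ideal_subset by blast
  show "a \<otimes>\<^bsub>R\<^esub> x \<in> max_ideal U M"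
    using ax x by (simp add: fg mult_HC max_ideal_mult)
  then show "x \<otimes>\<^bsub>R\<^esub> a \<in> max_ideal U M"
    using ax x max_ideal_subset R.m_comm[of a x] by auto
qed (rule R.ring_axioms)

sublocale hat: ring_hom_ring R L "hat U M"
  unfolding asymptotic_field_def
  using ideal.rcos_ring_hom_ring[OF ideal_max_ideal] by (simp add: hat_def[abs_def])

abbreviation h :: "('i \<Rightarrow> complex) \<Rightarrow> 'i hcomplex set" where
  "h f \<equiv> hat U M (star_class U f)"

lemma carrier_L: "carrier L = hat U M ` M"
  by (auto simp: asymptotic_field_def FactRing_def A_RCOSETS_def' hat_def)

lemma h_carrier: "star_class U f \<in> M \<Longrightarrow> h f \<in> carrier L"
  by (simp add: carrier_L)

lemma carrier_L_E:
  assumes "x \<in> carrier L"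
  obtains f where "x = h f" "star_class U f \<in> M"
proof -
  obtain z where "x = hat U M z" "z \<in> M"
    using assms by (auto simp: carrier_L)
  moreover from this obtain f where "z = star_class U f"
    using M_subset by blast
  ultimately show ?thesis
    using that by simp
qed

lemma h_eq_iff: "star_class U f \<in> M \<Longrightarrow> star_class U g \<in> M \<Longrightarrow>
    h f = h g \<longleftrightarrow> star_class U (\<lambda>i. f i - g i) \<in> max_ideal U M"
  using R.quotient_eq_iff_same_a_r_cos[OF ideal_max_ideal, of "star_class U f" "star_class U g"]
  by (simp add: minus_R hat_def)

lemma h_add: "star_class U f \<in> M \<Longrightarrow> star_class U g \<in> M \<Longrightarrow> h f \<oplus>\<^bsub>L\<^esub> h g = h (\<lambda>i. f i + g i)"
  using hat.hom_add[of "star_class U f" "star_class U g"] by (simp add: add_HC)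

lemma h_mult: "star_class U f \<in> M \<Longrightarrow> star_class U g \<in> M \<Longrightarrow> h f \<otimes>\<^bsub>L\<^esub> h g = h (\<lambda>i. f i * g i)"
  using hat.hom_mult[of "star_class U f" "star_class U g"] by (simp add: mult_HC)

lemma h_minus: "star_class U f \<in> M \<Longrightarrow> \<ominus>\<^bsub>L\<^esub> h f = h (\<lambda>i. - f i)"
  using hat.hom_a_inv[of "star_class U f"] by (simp add: a_inv_R)

lemma h_zero: "\<zero>\<^bsub>L\<^esub> = h (\<lambda>_. 0)"
  using hat.hom_zero by (simp add: zero_HC)

lemma h_one: "\<one>\<^bsub>L\<^esub> = h (\<lambda>_. 1)"
  using hat.hom_one by (simp add: one_HC)

lemma h_eq_zero_iff: "star_class U f \<in> M \<Longrightarrow> h f = \<zero>\<^bsub>L\<^esub> \<longleftrightarrow> star_class U f \<in> max_ideal U M"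
  using h_eq_iff[OF _ M_zero, of f] by (simp add: h_zero)

text \<open>The definition of the ideal says that a nonzero element of \<open>M\<close> outside it
  has its inverse in \<open>M\<close>. This provides explicit inverses for all nonzero residues and
  so makes the quotient a field.\<close>

lemma M_inverse:
  assumes "star_class U f \<in> M" "h f \<noteq> \<zero>\<^bsub>L\<^esub>"
  shows "star_class U (\<lambda>i. inverse (f i)) \<in> M" "\<forall>\<^sub>F i in U. f i \<noteq> 0"
proof -
  have *: "star_class U f \<notin> max_ideal U M"
    using assms by (simp add: h_eq_zero_iff)
  then have "star_class U f \<noteq> \<zero>\<^bsub>HC U\<^esub>"
    using assms(1) by (auto simp: max_ideal_def)
  then show nz: "\<forall>\<^sub>F i in U. f i \<noteq> 0"
    by (simp add: star_class_simps not_eventually_iff)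
  show "star_class U (\<lambda>i. inverse (f i)) \<in> M"
    using * assms(1) nz by (simp add: max_ideal_def m_inv_HC)
qed

lemma h_mult_inverse:
  assumes "star_class U f \<in> M" "h f \<noteq> \<zero>\<^bsub>L\<^esub>"
  shows "h f \<otimes>\<^bsub>L\<^esub> h (\<lambda>i. inverse (f i)) = \<one>\<^bsub>L\<^esub>"
proof -
  have "star_class U (\<lambda>i. f i * inverse (f i)) = star_class U (\<lambda>_. 1)"
    using M_inverse(2)[OF assms] by (auto simp: star_class_simps elim: eventually_mono)
  then show ?thesis
    unfolding h_one h_mult[OF assms(1) M_inverse(1)[OF assms]] by simp
qed

lemma field_L: "field L"
proof -
  interpret L: cring L
    unfolding asymptotic_field_def
    by (rule ideal.quotient_is_cring[OF ideal_max_ideal R.cring_axioms])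
  show ?thesis
  proof (rule L.cring_fieldI2)
    show "\<zero>\<^bsub>L\<^esub> \<noteq> \<one>\<^bsub>L\<^esub>"
      using h_eq_zero_iff[OF M_one] one_notin_max_ideal unfolding h_one by metis
  next
    fix x assume x: "x \<in> carrier L" "x \<noteq> \<zero>\<^bsub>L\<^esub>"
    from x(1) obtain f where f: "x = h f" "star_class U f \<in> M"
      by (rule carrier_L_E)
    show "\<exists>y\<in>carrier L. x \<otimes>\<^bsub>L\<^esub> y = \<one>\<^bsub>L\<^esub>"
    proof
      show "x \<otimes>\<^bsub>L\<^esub> h (\<lambda>i. inverse (f i)) = \<one>\<^bsub>L\<^esub>"
        unfolding f(1) by (rule h_mult_inverse) (use f x(2) in auto)
      show "h (\<lambda>i. inverse (f i)) \<in> carrier L"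
        by (rule h_carrier, rule M_inverse(1)) (use f x(2) in auto)
    qed
  qed
qed

sublocale L: field L
  by (rule field_L)

end

section \<open>The real part\<close>

context convex_ultra
begin

abbreviation cr :: "('i \<Rightarrow> real) \<Rightarrow> 'i hcomplex" where
  "cr a \<equiv> star_class U (\<lambda>i. complex_of_real (a i))"

abbreviation K :: "'i hcomplex set set" where
  "K \<equiv> carrier (real_part U M)"

abbreviation P :: "'i hcomplex set set" where
  "P \<equiv> real_part_pos U M"

text \<open>Links the two ways in which the completeness notions present the real part: as a
  restriction of the field \<open>L\<close>, and as a ring of its own.\<close>

lemma restrict_L_K: "L\<lparr>carrier := K\<rparr> = real_part U M"
  by (simp add: real_part_def)

lemma K_eq: "K = {hat U M (cr a) | a. cr a \<in> M}"
proof -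
  have "hcomplex_of_hreal U ` HR U = range cr"
    unfolding HR_def ultrapower_def image_image star_map_star_class ..
  then show ?thesis
    by (auto simp: real_part_def)
qed

lemma K_I: "cr a \<in> M \<Longrightarrow> hat U M (cr a) \<in> K"
  by (auto simp: K_eq)

lemma K_E:
  assumes "x \<in> K"
  obtains a where "x = hat U M (cr a)" "cr a \<in> M"
  using assms by (auto simp: K_eq)

lemma P_E:
  assumes "x \<in> P"
  obtains a where "x = hat U M (cr a)" "cr a \<in> M" "cr a \<notin> max_ideal U M" "\<forall>\<^sub>F i in U. 0 < a i"
proof -
  obtain y where y: "x = hat U M (hcomplex_of_hreal U y)" "y \<in> HR U" "hcomplex_of_hreal U y \<in> M"
    "hat U M (hcomplex_of_hreal U y) \<noteq> \<zero>\<^bsub>L\<^esub>" "hless U (hconst U 0) y"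
    using assms by (auto simp: real_part_pos_def)
  then obtain a where "y = star_class U a"
    by (auto simp: HR_def ultrapower_def)
  with y show ?thesis
    by (intro that[of a]) (simp_all add: star_map_star_class star_rel_star_class h_eq_zero_iff)
qed

lemma P_I:
  assumes "cr a \<in> M" "cr a \<notin> max_ideal U M" "\<forall>\<^sub>F i in U. 0 < a i"
  shows "hat U M (cr a) \<in> P"
  unfolding real_part_pos_def
  using assms
  by (auto intro!: exI[of _ "star_class U a"]
      simp: HR_def ultrapower_def star_map_star_class star_rel_star_class h_eq_zero_iff)

text \<open>Positivity does not depend on the representative: if \<open>b\<close> were positive and
  \<open>a\<close> nonpositive with the same residue, then \<open>b\<close> would be bounded by the
  absolute value of \<open>a - b\<close>, which lies in the ideal, and convexity would put
  \<open>b\<close> into the ideal as well.\<close>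

lemma P_iff:
  assumes "cr a \<in> M"
  shows "hat U M (cr a) \<in> P \<longleftrightarrow> cr a \<notin> max_ideal U M \<and> (\<forall>\<^sub>F i in U. 0 < a i)"
proof
  assume "hat U M (cr a) \<in> P"
  then obtain b where eq: "hat U M (cr a) = hat U M (cr b)"
    and b: "cr b \<in> M" "cr b \<notin> max_ideal U M" "\<forall>\<^sub>F i in U. 0 < b i"
    by (rule P_E)
  have a: "cr a \<notin> max_ideal U M"
    using h_eq_zero_iff[OF assms] h_eq_zero_iff[OF b(1)] eq b(2) by simp
  have "\<forall>\<^sub>F i in U. 0 < a i"
  proof (rule ccontr)
    assume "\<not> ?thesis"
    then have "\<forall>\<^sub>F i in U. a i \<le> 0"
      by (simp add: not_eventually_iff not_less)
    with b(3) have "\<forall>\<^sub>F i in U. cmod (of_real (b i)) \<le> cmod (of_real (a i) - of_real (b i))"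
      by eventually_elim (simp flip: of_real_diff)
    moreover have "star_class U (\<lambda>i. complex_of_real (a i) - of_real (b i)) \<in> max_ideal U M"
      using eq by (simp add: h_eq_iff assms b)
    ultimately show False
      using b(2) max_ideal_convex[of "\<lambda>i. complex_of_real (a i) - of_real (b i)"] by simp
  qed
  with a show "cr a \<notin> max_ideal U M \<and> (\<forall>\<^sub>F i in U. 0 < a i)"
    by blast
qed (simp add: assms P_I)

lemma cr_add: "cr a \<in> M \<Longrightarrow> cr b \<in> M \<Longrightarrow> cr (\<lambda>i. a i + b i) \<in> M"
  using M_add[of "\<lambda>i. complex_of_real (a i)" "\<lambda>i. complex_of_real (b i)"] by simp

lemma cr_minus: "cr a \<in> M \<Longrightarrow> cr (\<lambda>i. - a i) \<in> M"
  using M_minus[of "\<lambda>i. complex_of_real (a i)"] by simp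

lemma cr_diff: "cr a \<in> M \<Longrightarrow> cr b \<in> M \<Longrightarrow> cr (\<lambda>i. a i - b i) \<in> M"
  using M_diff[of "\<lambda>i. complex_of_real (a i)" "\<lambda>i. complex_of_real (b i)"] by simp

lemma cr_mult: "cr a \<in> M \<Longrightarrow> cr b \<in> M \<Longrightarrow> cr (\<lambda>i. a i * b i) \<in> M"
  using M_mult[of "\<lambda>i. complex_of_real (a i)" "\<lambda>i. complex_of_real (b i)"] by simp

lemma hat_cr_add: "cr a \<in> M \<Longrightarrow> cr b \<in> M \<Longrightarrow>
    hat U M (cr a) \<oplus>\<^bsub>L\<^esub> hat U M (cr b) = hat U M (cr (\<lambda>i. a i + b i))"
  by (simp add: h_add)

lemma hat_cr_mult: "cr a \<in> M \<Longrightarrow> cr b \<in> M \<Longrightarrow>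
    hat U M (cr a) \<otimes>\<^bsub>L\<^esub> hat U M (cr b) = hat U M (cr (\<lambda>i. a i * b i))"
  by (simp add: h_mult)

lemma hat_cr_minus: "cr a \<in> M \<Longrightarrow> \<ominus>\<^bsub>L\<^esub> hat U M (cr a) = hat U M (cr (\<lambda>i. - a i))"
  by (simp add: h_minus)

lemma subfield_K: "subfield K L"
proof (rule L.subfieldI')
  show "subring K L"
  proof (rule hat.S.subringI)
    show "K \<subseteq> carrier L"
      by (auto simp: K_eq h_carrier)
    show "\<one>\<^bsub>L\<^esub> \<in> K"
      using K_I[of "\<lambda>_. 1"] by (simp add: h_one M_one)
  next
    fix x assume "x \<in> K"
    then obtain a where a: "x = hat U M (cr a)" "cr a \<in> M"
      by (rule K_E)
    show "\<ominus>\<^bsub>L\<^esub> x \<in> K"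
      unfolding a(1) hat_cr_minus[OF a(2)] by (intro K_I cr_minus a)
  next
    fix x y assume "x \<in> K" "y \<in> K"
    then obtain a b where ab: "x = hat U M (cr a)" "y = hat U M (cr b)" "cr a \<in> M" "cr b \<in> M"
      by (elim K_E)
    show "x \<oplus>\<^bsub>L\<^esub> y \<in> K"
      unfolding ab(1,2) hat_cr_add[OF ab(3,4)] by (intro K_I cr_add ab)
    show "x \<otimes>\<^bsub>L\<^esub> y \<in> K"
      unfolding ab(1,2) hat_cr_mult[OF ab(3,4)] by (intro K_I cr_mult ab)
  qed
next
  fix k assume k: "k \<in> K - {\<zero>\<^bsub>L\<^esub>}"
  then have "k \<in> K"
    by simp
  then obtain a where a: "k = hat U M (cr a)" "cr a \<in> M"
    by (rule K_E)
  have nz: "hat U M (cr a) \<noteq> \<zero>\<^bsub>L\<^esub>"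
    using k by (simp add: a)
  have inv: "star_class U (\<lambda>i. inverse (complex_of_real (a i))) \<in> M"
    by (rule M_inverse(1)[OF a(2) nz])
  have "inv\<^bsub>L\<^esub> k = h (\<lambda>i. inverse (complex_of_real (a i)))"
    unfolding a(1) by (intro L.comm_inv_char h_carrier a inv h_mult_inverse nz)
  also have "\<dots> \<in> K"
    using K_I[of "\<lambda>i. inverse (a i)"] inv by simp
  finally show "inv\<^bsub>L\<^esub> k \<in> K" .
qed

section \<open>The real part as an ordered field\<close>

lemma add_real_part: "x \<oplus>\<^bsub>real_part U M\<^esub> y = x \<oplus>\<^bsub>L\<^esub> y"
  and mult_real_part: "x \<otimes>\<^bsub>real_part U M\<^esub> y = x \<otimes>\<^bsub>L\<^esub> y"
  and zero_real_part: "\<zero>\<^bsub>real_part U M\<^esub> = \<zero>\<^bsub>L\<^esub>"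
  by (simp_all add: real_part_def)

lemma field_real_part: "field (real_part U M)"
  using hat.S.subfield_iff(2)[OF subfield_K] unfolding restrict_L_K .

lemma ring_real_part: "ring (real_part U M)"
  using field_real_part by (simp add: field_def domain_def cring_def)

lemma a_inv_real_part:
  assumes "cr a \<in> M"
  shows "\<ominus>\<^bsub>real_part U M\<^esub> hat U M (cr a) = hat U M (cr (\<lambda>i. - a i))"
proof (rule abelian_group.minus_equality[OF ring.is_abelian_group[OF ring_real_part]])
  show "hat U M (cr (\<lambda>i. - a i)) \<oplus>\<^bsub>real_part U M\<^esub> hat U M (cr a) = \<zero>\<^bsub>real_part U M\<^esub>"
    unfolding add_real_part zero_real_part hat_cr_add[OF cr_minus[OF assms] assms] h_zero by simp
qed (intro K_I cr_minus assms)+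

text \<open>The disjunction separates the case where representatives carry no order information,
  equal residues, from the strict case, where any representatives may be compared pointwise. If
  \<open>b - a\<close> lies in the ideal, the residues are equal; otherwise \<open>P_iff\<close>
  decides.\<close>

lemma of_le_iff:
  assumes "cr a \<in> M" "cr b \<in> M"
  shows "of_le (real_part U M) P (hat U M (cr a)) (hat U M (cr b)) \<longleftrightarrow>
    hat U M (cr a) = hat U M (cr b) \<or> (\<forall>\<^sub>F i in U. a i < b i)"
proof -
  have "hat U M (cr b) \<ominus>\<^bsub>real_part U M\<^esub> hat U M (cr a) = hat U M (cr (\<lambda>i. b i - a i))"
    unfolding a_minus_def a_inv_real_part[OF assms(1)] add_real_part
      hat_cr_add[OF assms(2) cr_minus[OF assms(1)]] by simp
  moreover have "hat U M (cr b) = hat U M (cr a) \<longleftrightarrow> cr (\<lambda>i. b i - a i) \<in> max_ideal U M"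
    using h_eq_iff[OF assms(2,1)] by simp
  moreover have "hat U M (cr (\<lambda>i. b i - a i)) \<in> P \<longleftrightarrow>
      cr (\<lambda>i. b i - a i) \<notin> max_ideal U M \<and> (\<forall>\<^sub>F i in U. 0 < b i - a i)"
    by (rule P_iff[OF cr_diff[OF assms(2,1)]])
  ultimately show ?thesis
    by (auto simp: of_le_def)
qed

lemma ordered_field_real_part: "ordered_field (real_part U M) P"
  unfolding ordered_field_def
proof (intro conjI ballI field_real_part)
  show "P \<subseteq> K"
    by (auto elim!: P_E intro: K_I)
  show "\<zero>\<^bsub>real_part U M\<^esub> \<notin> P"
    by (auto simp: real_part_pos_def zero_real_part)
next
  fix x y assume xy: "x \<in> P" "y \<in> P"
  obtain a where a: "x = hat U M (cr a)" "cr a \<in> M" "cr a \<notin> max_ideal U M" "\<forall>\<^sub>F i in U. 0 < a i"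
    using xy(1) by (rule P_E)
  obtain b where b: "y = hat U M (cr b)" "cr b \<in> M" "cr b \<notin> max_ideal U M" "\<forall>\<^sub>F i in U. 0 < b i"
    using xy(2) by (rule P_E)
  \<comment> \<open>Positive terms cannot cancel: if the sum were in the ideal, convexity would put
    \<open>a\<close> there too.\<close>
  have "\<forall>\<^sub>F i in U. cmod (of_real (a i)) \<le> cmod (of_real (a i + b i))"
    using a(4) b(4) by eventually_elim (simp del: of_real_add)
  from max_ideal_convex[OF _ this] have "cr (\<lambda>i. a i + b i) \<notin> max_ideal U M"
    using a(3) by blast
  moreover have "\<forall>\<^sub>F i in U. 0 < a i + b i"
    using a(4) b(4) by eventually_elim simp
  ultimately show "x \<oplus>\<^bsub>real_part U M\<^esub> y \<in> P"
    unfolding add_real_part a(1) b(1) hat_cr_add[OF a(2) b(2)] by (intro P_I cr_add a b)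
  \<comment> \<open>For the product, the absence of zero divisors in the field \<open>L\<close>
    takes the place of an estimate.\<close>
  have "x \<otimes>\<^bsub>L\<^esub> y \<noteq> \<zero>\<^bsub>L\<^esub>"
    using a b by (simp add: L.integral_iff h_carrier h_eq_zero_iff)
  then have "cr (\<lambda>i. a i * b i) \<notin> max_ideal U M"
    unfolding a(1) b(1) hat_cr_mult[OF a(2) b(2)] using h_eq_zero_iff[OF cr_mult[OF a(2) b(2)]] by blast
  moreover have "\<forall>\<^sub>F i in U. 0 < a i * b i"
    using a(4) b(4) by eventually_elim simp
  ultimately show "x \<otimes>\<^bsub>real_part U M\<^esub> y \<in> P"
    unfolding mult_real_part a(1) b(1) hat_cr_mult[OF a(2) b(2)] by (intro P_I cr_mult a b)
next
  fix x assume "x \<in> K"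
  then obtain a where a: "x = hat U M (cr a)" "cr a \<in> M"
    by (rule K_E)
  show "x = \<zero>\<^bsub>real_part U M\<^esub> \<or> x \<in> P \<or> \<ominus>\<^bsub>real_part U M\<^esub> x \<in> P"
  proof (cases "cr a \<in> max_ideal U M")
    case True
    then show ?thesis
      by (simp add: a zero_real_part h_eq_zero_iff)
  next
    case False
    have False': "cr (\<lambda>i. - a i) \<notin> max_ideal U M"
      using False max_ideal_minus[of "\<lambda>i. complex_of_real (- a i)"] by auto
    consider "\<forall>\<^sub>F i in U. 0 < a i" | "\<forall>\<^sub>F i in U. 0 < - a i" | "\<forall>\<^sub>F i in U. a i = 0"
    proof -
      have "(\<forall>\<^sub>F i in U. 0 < - a i)" if "\<not> (\<forall>\<^sub>F i in U. 0 < a i)" "\<not> (\<forall>\<^sub>F i in U. a i = 0)"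
        using that unfolding not_eventually_iff by eventually_elim auto
      with that show ?thesis
        by blast
    qed
    then show ?thesis
    proof cases
      case 1
      with False a show ?thesis
        by (simp add: P_I)
    next
      case 2
      with False' have "hat U M (cr (\<lambda>i. - a i)) \<in> P"
        by (intro P_I cr_minus a)
      then show ?thesis
        unfolding a(1) a_inv_real_part[OF a(2)] by blast
    next
      case 3
      then have "cr a = star_class U (\<lambda>_. 0)"
        by (auto simp: star_class_eq_iff)
      with False zero_in_max_ideal show ?thesis
        by simp
    qed
  qed
qed

text \<open>Real and imaginary parts are bounded by the absolute value, so convexity keeps both in
  \<open>M\<close>, and the decomposition into them passes to residues.\<close>

lemma adjoin_i_real_part: "adjoin_i L K"
  unfolding adjoin_i_def
proof (intro conjI field_L subfield_K bexI)
  let ?i = "h (\<lambda>_. \<i>)"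
  have i: "star_class U (\<lambda>_. \<i>) \<in> M"
    using M_one by (rule M_convex) simp
  then show i_L: "?i \<in> carrier L"
    by (rule h_carrier)
  show "?i \<otimes>\<^bsub>L\<^esub> ?i = \<ominus>\<^bsub>L\<^esub> \<one>\<^bsub>L\<^esub>"
    unfolding h_one h_mult[OF i i] h_minus[OF M_one] by simp
  have sub: "insert ?i K \<subseteq> carrier L"
    using i_L subfieldE(3)[OF subfield_K] by blast
  show "carrier L = generate_field L (insert ?i K)"
  proof
    show "generate_field L (insert ?i K) \<subseteq> carrier L"
      by (rule L.generate_field_incl[OF sub])
    show "carrier L \<subseteq> generate_field L (insert ?i K)"
    proof
      fix x assume "x \<in> carrier L"
      then obtain f where f: "x = h f" "star_class U f \<in> M"
        by (rule carrier_L_E)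
      have Re: "cr (\<lambda>i. Re (f i)) \<in> M"
        using f(2) by (rule M_convex) (simp add: abs_Re_le_cmod)
      have Im: "cr (\<lambda>i. Im (f i)) \<in> M"
        using f(2) by (rule M_convex) (simp add: abs_Im_le_cmod)
      have "x = hat U M (cr (\<lambda>i. Re (f i))) \<oplus>\<^bsub>L\<^esub> ?i \<otimes>\<^bsub>L\<^esub> hat U M (cr (\<lambda>i. Im (f i)))"
        unfolding h_mult[OF i Im] h_add[OF Re M_mult[OF i Im]] f(1) complex_eq[symmetric] ..
      also have "\<dots> \<in> generate_field L (insert ?i K)"
        by (intro generate_field.eng_add generate_field.eng_mult generate_field.incl insertI1
            insertI2 K_I Re Im)
      finally show "x \<in> generate_field L (insert ?i K)" .
    qed
  qed
qed


section \<open>Cantor completeness\<close>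

text \<open>Saturation speaks of internal subsets of the nonstandard complex numbers, so real
  intervals are embedded before it is applied.\<close>

lemma internal_interval:
  "internal_set U {star_class U f | f. \<forall>\<^sub>F i in U. f i \<in> complex_of_real ` {a i..b i}}"
  unfolding internal_set_def by (rule exI[of _ "\<lambda>i. complex_of_real ` {a i..b i}"]) (rule refl)

lemma cantor_complete_real_part:
  fixes \<kappa> :: "'k rel"
  assumes sat: "saturated \<kappa> U"
  shows "cantor_complete \<kappa> (real_part U M) P"
  unfolding cantor_complete_def
proof (intro conjI ordered_field_real_part allI impI, elim conjE)
  fix \<C> :: "'i hcomplex set set set"
  assume ints: "\<forall>C\<in>\<C>. \<exists>x\<in>K. \<exists>y\<in>K. C = of_interval (real_part U M) P x y"
    and card: "|\<C>| <o \<kappa>"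
    and fip: "\<forall>\<D>\<subseteq>\<C>. finite \<D> \<longrightarrow> (\<exists>x\<in>K. \<forall>D\<in>\<D>. x \<in> D)"
  let ?le = "of_le (real_part U M) P"
  have "\<forall>C\<in>\<C>. \<exists>p. cr (fst p) \<in> M \<and> cr (snd p) \<in> M \<and>
      C = of_interval (real_part U M) P (hat U M (cr (fst p))) (hat U M (cr (snd p)))"
  proof
    fix C assume "C \<in> \<C>"
    then obtain x y where xy: "x \<in> K" "y \<in> K" "C = of_interval (real_part U M) P x y"
      using ints by blast
    then obtain a b where "x = hat U M (cr a)" "cr a \<in> M" "y = hat U M (cr b)" "cr b \<in> M"
      by (elim K_E)
    with xy(3) show "\<exists>p. cr (fst p) \<in> M \<and> cr (snd p) \<in> M \<and>
        C = of_interval (real_part U M) P (hat U M (cr (fst p))) (hat U M (cr (snd p)))"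
      by (intro exI[of _ "(a, b)"]) simp
  qed
  \<comment> \<open>Endpoints are chosen once for each interval regarded as a set, so the family
    itself serves as the index set and its cardinality is not increased.\<close>
  from bchoice[OF this] obtain p where p: "\<forall>C\<in>\<C>. cr (fst (p C)) \<in> M \<and> cr (snd (p C)) \<in> M \<and>
      C = of_interval (real_part U M) P (hat U M (cr (fst (p C)))) (hat U M (cr (snd (p C))))"
    by blast
  define a b where "a C = fst (p C)" and "b C = snd (p C)" for C
  have a: "\<And>C. C \<in> \<C> \<Longrightarrow> cr (a C) \<in> M" and b: "\<And>C. C \<in> \<C> \<Longrightarrow> cr (b C) \<in> M"
    and C: "\<And>C. C \<in> \<C> \<Longrightarrow> C = of_interval (real_part U M) P (hat U M (cr (a C))) (hat U M (cr (b C)))"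
    using p by (simp_all add: a_def b_def)
  have mem_iff: "x \<in> C \<longleftrightarrow> x \<in> K \<and> ?le (hat U M (cr (a C))) x \<and> ?le x (hat U M (cr (b C)))"
    if "C \<in> \<C>" for C x
    by (subst C[OF that]) (simp add: of_interval_def)
  \<comment> \<open>Two-element subfamilies suffice: a common point separates every left endpoint
    from every right endpoint.\<close>
  have cross: "?le (hat U M (cr (a C))) (hat U M (cr (b D)))"
    if CD: "C \<in> \<C>" "D \<in> \<C>" for C D
  proof -
    obtain x where x: "x \<in> K" "x \<in> C" "x \<in> D"
      using fip[rule_format, of "{C, D}"] CD by auto
    obtain c where c: "x = hat U M (cr c)" "cr c \<in> M"
      using x(1) by (rule K_E)
    have le: "?le (hat U M (cr (a C))) (hat U M (cr c))" "?le (hat U M (cr c)) (hat U M (cr (b D)))"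
      using x(2,3) unfolding mem_iff[OF CD(1)] mem_iff[OF CD(2)] c(1) by blast+
    show ?thesis
    \<comment> \<open>Transitivity of the order: an equality is substituted, and two strict
      inequalities are chained on representatives.\<close>
    proof (cases "hat U M (cr (a C)) = hat U M (cr c) \<or> hat U M (cr c) = hat U M (cr (b D))")
      case True
      then show ?thesis
        using le by (elim disjE) simp_all
    next
      case False
      then have "\<forall>\<^sub>F i in U. a C i < c i" "\<forall>\<^sub>F i in U. c i < b D i"
        using le of_le_iff[OF a[OF CD(1)] c(2)] of_le_iff[OF c(2) b[OF CD(2)]] by blast+
      then have "\<forall>\<^sub>F i in U. a C i < b D i"
        by eventually_elim simp
      then show ?thesis
        using of_le_iff[OF a[OF CD(1)] b[OF CD(2)]] by blast
    qed
  qed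
  show "\<exists>x\<in>K. \<forall>C\<in>\<C>. x \<in> C"
  proof (cases "\<exists>C\<in>\<C>. \<exists>D\<in>\<C>. hat U M (cr (a C)) = hat U M (cr (b D))")
    case True
    then obtain C D where CD: "C \<in> \<C>" "D \<in> \<C>" "hat U M (cr (a C)) = hat U M (cr (b D))"
      by blast
    have "hat U M (cr (a C)) \<in> E" if E: "E \<in> \<C>" for E
    proof -
      have "?le (hat U M (cr (a E))) (hat U M (cr (a C)))"
        unfolding CD(3) by (rule cross[OF E CD(2)])
      with cross[OF CD(1) E] show ?thesis
        unfolding mem_iff[OF E] using K_I[OF a[OF CD(1)]] by blast
    qed
    then show ?thesis
      using K_I[OF a[OF CD(1)]] by blast
  next
    case False
    with cross have less: "\<forall>\<^sub>F i in U. a C i < b D i" if "C \<in> \<C>" "D \<in> \<C>" for C D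
      using that of_le_iff[OF a[OF that(1)] b[OF that(2)]] by blast
    show ?thesis
    \<comment> \<open>With no interval there would be no endpoints to bound the point given by
      saturation, so it could lie outside \<open>M\<close>; here any element of \<open>K\<close>
      will do.\<close>
    proof (cases "\<C> = {}")
      case True
      then show ?thesis
        using ring.ring_simprules(2)[OF ring_real_part] by blast
    next
      case nonempty: False
      define I where "I C = {star_class U f | f. \<forall>\<^sub>F i in U. f i \<in> complex_of_real ` {a C i..b C i}}" for C
      have "|I ` \<C>| \<le>o \<kappa>"
        using ordLeq_ordLess_trans[OF card_of_image card] ordLess_imp_ordLeq by blast
      moreover have "internal_set U A" if "A \<in> I ` \<C>" for A
        using that internal_interval by (auto simp: I_def)
      moreover have "\<exists>z\<in>carrier (HC U). \<forall>B\<in>\<B>. z \<in> B" if B: "\<B> \<subseteq> I ` \<C>" "finite \<B>" for \<B>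
      proof -
        obtain \<D> where D: "\<D> \<subseteq> \<C>" "finite \<D>" "\<B> = I ` \<D>"
          using finite_subset_image[OF B(2,1)] by blast
        show ?thesis
        proof (cases "\<D> = {}")
          case True
          then show ?thesis
            using D by (auto simp: carrier_HC)
        next
          case False
          \<comment> \<open>The pointwise largest left endpoint. Finitely many strict inequalities
            hold simultaneously at eventually all indices, so it stays below every right endpoint.
            \<open>Max\<close> requires the case \<open>\<D> = {}\<close> to be split off.\<close>
          define m where "m i = Max ((\<lambda>C. a C i) ` \<D>)" for i
          have "cr m \<in> I E" if E: "E \<in> \<D>" for E
          proof -
            have "\<forall>\<^sub>F i in U. \<forall>C\<in>\<D>. a C i < b E i"
              using D E less by (intro eventually_ball_finite) auto
            then have "\<forall>\<^sub>F i in U. complex_of_real (m i) \<in> complex_of_real ` {a E i..b E i}"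
            proof eventually_elim
              case (elim i)
              then have "m i \<le> b E i"
                unfolding m_def using D False by (subst Max_le_iff) (auto intro: less_imp_le)
              moreover have "a E i \<le> m i"
                unfolding m_def using D E by (intro Max_ge) auto
              ultimately show ?case
                by simp
            qed
            then show ?thesis
              by (auto simp: I_def)
          qed
          then show ?thesis
            using D(3) by (intro bexI[of _ "cr m"]) (auto simp: carrier_HC)
        qed
      qed
      ultimately have "\<exists>z\<in>carrier (HC U). \<forall>A\<in>I ` \<C>. z \<in> A"
        using sat[unfolded saturated_def, rule_format, of "I ` \<C>"] by simp
      then obtain z where z: "\<forall>C\<in>\<C>. z \<in> I C"
        by auto
      obtain D where D: "D \<in> \<C>"
        using nonempty by blast
      obtain f where f: "z = star_class U f"
        using z D by (auto simp: I_def)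
      \<comment> \<open>The representative \<open>f\<close> is real only eventually; its real part
        is real at every index and agrees with \<open>f\<close> wherever \<open>f\<close> lies in
        one of the embedded intervals.\<close>
      define c where "c i = Re (f i)" for i
      \<comment> \<open>Membership in \<open>I C\<close> provides a representative that may vary
        with \<open>C\<close>; the condition is moved to the single \<open>f\<close>.\<close>
      have f_I: "\<forall>\<^sub>F i in U. f i \<in> complex_of_real ` {a C i..b C i}" if "C \<in> \<C>" for C
      proof -
        have "z \<in> I C"
          using z that by blast
        then obtain g where "\<forall>\<^sub>F i in U. f i = g i" "\<forall>\<^sub>F i in U. g i \<in> complex_of_real ` {a C i..b C i}"
          by (auto simp: I_def f star_class_eq_iff)
        then show ?thesis
          by eventually_elim simp
      qed
      have between: "\<forall>\<^sub>F i in U. a C i \<le> c i \<and> c i \<le> b C i" if "C \<in> \<C>" for C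
        using f_I[OF that] by eventually_elim (auto simp: c_def)
      have "cr c \<in> M"
      proof (rule M_convex)
        \<comment> \<open>A number between two endpoints is bounded by the sum of their absolute
          values, whatever their signs; one interval is enough for this bound.\<close>
        show "cr (\<lambda>i. \<bar>a D i\<bar> + \<bar>b D i\<bar>) \<in> M"
        proof (rule cr_add)
          show "cr (\<lambda>i. \<bar>a D i\<bar>) \<in> M"
            using a[OF D] by (rule M_convex) simp
          show "cr (\<lambda>i. \<bar>b D i\<bar>) \<in> M"
            using b[OF D] by (rule M_convex) simp
        qed
        show "\<forall>\<^sub>F i in U. cmod (of_real (c i)) \<le> cmod (of_real (\<bar>a D i\<bar> + \<bar>b D i\<bar>))"
          using between[OF D] by eventually_elim (unfold norm_of_real, linarith)
      qed
      moreover have "hat U M (cr c) \<in> C" if "C \<in> \<C>" for C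
      proof -
        \<comment> \<open>A weak inequality of representatives is eventually strict or eventually an
          equality, and either alternative gives the weak inequality of residues.\<close>
        have le: "?le (hat U M (cr x)) (hat U M (cr y))"
          if M: "cr x \<in> M" "cr y \<in> M" and xy: "\<forall>\<^sub>F i in U. x i \<le> y i" for x y
        proof (cases "\<forall>\<^sub>F i in U. x i < y i")
          case True
          then show ?thesis
            using of_le_iff[OF M] by blast
        next
          case False
          then have "\<forall>\<^sub>F i in U. \<not> x i < y i"
            by (simp add: not_eventually_iff)
          with xy have "\<forall>\<^sub>F i in U. complex_of_real (x i) = of_real (y i)"
            by eventually_elim simp
          then have "cr x = cr y"
            by (simp add: star_class_eq_iff)
          then show ?thesis
            by (simp add: of_le_def)
        qed
        have "\<forall>\<^sub>F i in U. a C i \<le> c i" "\<forall>\<^sub>F i in U. c i \<le> b C i"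
          using between[OF that] by (auto simp: eventually_conj_iff)
        then show ?thesis
          unfolding mem_iff[OF that] using \<open>cr c \<in> M\<close> a[OF that] b[OF that] by (intro conjI K_I le)
      qed
      ultimately show ?thesis
        using K_I by blast
    qed
  qed
qed

lemma asymptotic_field_complete:
  "saturated \<kappa> U \<Longrightarrow> asymptotic_field_complete \<kappa> U M"
  unfolding asymptotic_field_complete_def cantor_complete_adjoin_i_def restrict_L_K
  by (intro conjI adjoin_i_real_part cantor_complete_real_part)

lemma real_part_complete:
  "saturated \<kappa> U \<Longrightarrow> real_part_complete \<kappa> U M"
  unfolding real_part_complete_def by (rule cantor_complete_real_part)

end

section \<open>The four scales\<close>

context ultra
begin

lemma star_map_funpow_star_class:
  fixes F :: "'a \<Rightarrow> 'a"
  shows "(star_map U F ^^ n) (star_class U f) = star_class U (\<lambda>i. (F ^^ n) (f i))"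
  by (induction n) (simp_all add: star_map_star_class)

text \<open>For rings cut out by all bounds of a scale: below each bound there must be another whose
  double and square still fit under it. The condition \<open>1 < b n i\<close> puts the identity
  into the ring.\<close>

lemma convex_subring_less:
  fixes b :: "nat \<Rightarrow> 'i \<Rightarrow> real"
  assumes b: "\<And>n. n \<ge> 1 \<Longrightarrow>
    \<exists>m\<ge>1. \<forall>\<^sub>F i in U. 1 < b n i \<and> 2 * b m i \<le> b n i \<and> (b m i)\<^sup>2 \<le> b n i"
  shows "convex_subring U {z \<in> carrier (HC U). \<forall>n\<ge>1. hless U (hcmod U z) (star_class U (b n))}"
    (is "convex_subring U ?M")
proof -
  have M_iff: "star_class U f \<in> ?M \<longleftrightarrow> (\<forall>n\<ge>1. \<forall>\<^sub>F i in U. cmod (f i) < b n i)" for f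
    by (simp add: carrier_HC star_map_star_class star_rel_star_class)
  show ?thesis
  proof (rule convex_subringI)
    show "?M \<subseteq> carrier (HC U)"
      by blast
    show "star_class U (\<lambda>_. 1) \<in> ?M"
      unfolding M_iff using b by (force elim: eventually_mono)
  next
    fix f g assume g: "star_class U g \<in> ?M" and le: "\<forall>\<^sub>F i in U. cmod (f i) \<le> cmod (g i)"
    show "star_class U f \<in> ?M"
      unfolding M_iff
    proof (intro allI impI)
      fix n :: nat assume "n \<ge> 1"
      then have "\<forall>\<^sub>F i in U. cmod (g i) < b n i"
        using g unfolding M_iff by blast
      with le show "\<forall>\<^sub>F i in U. cmod (f i) < b n i"
        by eventually_elim simp
    qed
  next
    fix f g assume fg: "star_class U f \<in> ?M" "star_class U g \<in> ?M"
    have "\<forall>\<^sub>F i in U. cmod (f i + g i) < b n i \<and> cmod (f i * g i) < b n i" if n: "n \<ge> 1" for n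
    proof -
      obtain m where "m \<ge> 1"
        and m: "\<forall>\<^sub>F i in U. 1 < b n i \<and> 2 * b m i \<le> b n i \<and> (b m i)\<^sup>2 \<le> b n i"
        using b[OF n] by blast
      then have "\<forall>\<^sub>F i in U. cmod (f i) < b m i" "\<forall>\<^sub>F i in U. cmod (g i) < b m i"
        using fg unfolding M_iff by blast+
      with m show ?thesis
      proof eventually_elim
        case (elim i)
        have "cmod (f i + g i) < b n i"
          using norm_triangle_ineq[of "f i" "g i"] elim by linarith
        moreover have "cmod (f i) * cmod (g i) < b m i * b m i"
          using elim by (intro mult_strict_mono') auto
        ultimately show ?case
          using elim by (simp add: norm_mult power2_eq_square)
      qed
    qed
    then show "star_class U (\<lambda>i. f i + g i) \<in> ?M" "star_class U (\<lambda>i. f i * g i) \<in> ?M"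
      unfolding M_iff by (simp_all add: eventually_conj_iff)
  qed
qed

text \<open>The dual situation, a union over the scale: sums and products of two bounds must be
  absorbed by a further bound.\<close>

lemma convex_subring_le:
  fixes b :: "nat \<Rightarrow> 'i \<Rightarrow> real"
  assumes one: "\<forall>\<^sub>F i in U. 1 \<le> b 1 i"
    and b: "\<And>m n. m \<ge> 1 \<Longrightarrow> n \<ge> 1 \<Longrightarrow>
      \<exists>k\<ge>1. \<forall>\<^sub>F i in U. b m i + b n i \<le> b k i \<and> b m i * b n i \<le> b k i"
  shows "convex_subring U {z \<in> carrier (HC U). \<exists>n\<ge>1. hle U (hcmod U z) (star_class U (b n))}"
    (is "convex_subring U ?M")
proof -
  have M_iff: "star_class U f \<in> ?M \<longleftrightarrow> (\<exists>n\<ge>1. \<forall>\<^sub>F i in U. cmod (f i) \<le> b n i)" for f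
    by (simp add: carrier_HC star_map_star_class star_rel_star_class)
  show ?thesis
  proof (rule convex_subringI)
    show "?M \<subseteq> carrier (HC U)"
      by blast
    show "star_class U (\<lambda>_. 1) \<in> ?M"
      unfolding M_iff using one by (intro exI[of _ 1]) simp
  next
    fix f g assume g: "star_class U g \<in> ?M" and le: "\<forall>\<^sub>F i in U. cmod (f i) \<le> cmod (g i)"
    obtain n where "n \<ge> 1" and "\<forall>\<^sub>F i in U. cmod (g i) \<le> b n i"
      using g unfolding M_iff by blast
    from this(2) le have "\<forall>\<^sub>F i in U. cmod (f i) \<le> b n i"
      by eventually_elim simp
    with \<open>n \<ge> 1\<close> show "star_class U f \<in> ?M"
      unfolding M_iff by blast
  next
    fix f g assume "star_class U f \<in> ?M" "star_class U g \<in> ?M"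
    then obtain m n where mn: "m \<ge> 1" "n \<ge> 1"
      and fg: "\<forall>\<^sub>F i in U. cmod (f i) \<le> b m i" "\<forall>\<^sub>F i in U. cmod (g i) \<le> b n i"
      unfolding M_iff by blast
    obtain k where "k \<ge> 1"
      and k: "\<forall>\<^sub>F i in U. b m i + b n i \<le> b k i \<and> b m i * b n i \<le> b k i"
      using b[OF mn] by blast
    from k fg have "\<forall>\<^sub>F i in U. cmod (f i + g i) \<le> b k i"
    proof eventually_elim
      case (elim i)
      then show ?case
        using norm_triangle_ineq[of "f i" "g i"] by linarith
    qed
    with \<open>k \<ge> 1\<close> show "star_class U (\<lambda>i. f i + g i) \<in> ?M"
      unfolding M_iff by blast
    from k fg have "\<forall>\<^sub>F i in U. cmod (f i * g i) \<le> b k i"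
    proof eventually_elim
      case (elim i)
      have "cmod (f i) * cmod (g i) \<le> b m i * b n i"
        \<comment> \<open>The bounds are not assumed nonnegative; \<open>b m i\<close> is so here
          because it dominates an absolute value.\<close>
        using elim order_trans[OF norm_ge_zero elim(2)] by (intro mult_mono) auto
      with elim show ?case
        by (simp add: norm_mult)
    qed
    with \<open>k \<ge> 1\<close> show "star_class U (\<lambda>i. f i * g i) \<in> ?M"
      unfolding M_iff by blast
  qed
qed

end

text \<open>One application of \<open>exp\<close> absorbs both doubling and squaring. This makes a
  single step along the logarithmic or exponential scale sufficient.\<close>

lemma exp_ge_double_square:
  fixes s :: real
  assumes "0 \<le> s"
  shows "2 * s \<le> exp s" "s\<^sup>2 \<le> exp s"
proof -
  \<comment> \<open>Half of this is the difference between the quadratic Taylor polynomial of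
    \<open>exp\<close> at \<open>s\<close> and \<open>2 * s\<close>.\<close>
  have "0 \<le> (s - 1)\<^sup>2 + 1"
    by simp
  then have "2 * s \<le> 1 + s + s\<^sup>2 / 2"
    by (simp add: power2_eq_square algebra_simps)
  also have "\<dots> \<le> exp s"
    using exp_lower_Taylor_quadratic[OF assms] by simp
  finally show "2 * s \<le> exp s" .
  \<comment> \<open>One eighth of this is the Taylor polynomial at \<open>s / 2\<close> minus
    \<open>s\<close>; squaring \<open>s \<le> exp (s / 2)\<close> then gives the claim.\<close>
  have "0 \<le> (s - 2)\<^sup>2 + 4"
    by simp
  then have "s \<le> 1 + s / 2 + (s / 2)\<^sup>2 / 2"
    by (simp add: power2_eq_square algebra_simps)
  also have "\<dots> \<le> exp (s / 2)"
    using exp_lower_Taylor_quadratic[of "s / 2"] assms by simp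
  finally have "s\<^sup>2 \<le> (exp (s / 2))\<^sup>2"
    using assms by (intro power_mono)
  also have "\<dots> = exp s"
    by (simp add: power2_eq_square flip: exp_add)
  finally show "s\<^sup>2 \<le> exp s" .
qed

section \<open>The four rings attached to a positive infinitesimal\<close>

locale infinitesimal_ultra = ultra U for U :: "'i filter" +
  fixes r :: "'i \<Rightarrow> real"
  assumes infinitesimal: "pos_infinitesimal U (star_class U r)"
begin

lemma r_pos: "\<forall>\<^sub>F i in U. 0 < r i"
  using infinitesimal by (simp add: pos_infinitesimal_def star_rel_star_class)

lemma r_less:
  assumes "0 < c"
  shows "\<forall>\<^sub>F i in U. r i < c"
proof -
  obtain n :: nat where n: "n \<ge> 1" "1 / real n < c"
    using nat_approx_posE[OF assms] by (metis One_nat_def Suc_leI zero_less_Suc)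
  then have "\<forall>\<^sub>F i in U. r i < 1 / real n"
    using infinitesimal by (simp add: pos_infinitesimal_def star_rel_star_class)
  then show ?thesis
    using n(2) by (auto elim: eventually_mono)
qed

lemma inverse_r_greater: "\<forall>\<^sub>F i in U. c < 1 / r i"
proof -
  have "\<forall>\<^sub>F i in U. r i < 1 / (\<bar>c\<bar> + 1)"
    by (rule r_less) simp
  with r_pos show ?thesis
  proof eventually_elim
    case (elim i)
    then have "\<bar>c\<bar> + 1 < 1 / r i"
      by (simp add: field_simps)
    then show ?case
      by linarith
  qed
qed

text \<open>To exceed \<open>c\<close> after a logarithm, a quantity must exceed
  \<open>exp c\<close> before it, so the induction runs over all \<open>c\<close>. It also keeps the
  arguments of \<open>ln\<close> positive.\<close>

lemma funpow_ln_greater: "\<forall>\<^sub>F i in U. c < (ln ^^ n) (1 / r i)"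
proof (induction n arbitrary: c)
  case 0
  show ?case
    using inverse_r_greater by simp
next
  case (Suc n)
  show ?case
    using Suc[of "exp c"]
  proof eventually_elim
    case (elim i)
    then have "ln (exp c) < ln ((ln ^^ n) (1 / r i))"
      by (subst ln_less_cancel_iff) (auto intro: less_trans[OF exp_gt_zero])
    then show ?case
      by simp
  qed
qed

lemma convex_subring_L: "convex_subring U (L_ring U (star_class U r))"
  unfolding L_ring_def star_map_star_class star_map_funpow_star_class
proof (rule convex_subring_less)
  fix n :: nat assume "n \<ge> 1"
  \<comment> \<open>The next iterate is the witness: the current one is its exponential, which
    dominates its double and its square.\<close>
  have "\<forall>\<^sub>F i in U. 1 < (ln ^^ n) (1 / r i) \<and> 2 * (ln ^^ Suc n) (1 / r i) \<le> (ln ^^ n) (1 / r i)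
      \<and> ((ln ^^ Suc n) (1 / r i))\<^sup>2 \<le> (ln ^^ n) (1 / r i)"
    using funpow_ln_greater[of 1 n]
  proof eventually_elim
    case (elim i)
    then have "0 \<le> ln ((ln ^^ n) (1 / r i))" "exp (ln ((ln ^^ n) (1 / r i))) = (ln ^^ n) (1 / r i)"
      by auto
    then show ?case
      using elim exp_ge_double_square[of "ln ((ln ^^ n) (1 / r i))"] by simp
  qed
  then show "\<exists>m\<ge>1. \<forall>\<^sub>F i in U. 1 < (ln ^^ n) (1 / r i) \<and> 2 * (ln ^^ m) (1 / r i) \<le> (ln ^^ n) (1 / r i)
      \<and> ((ln ^^ m) (1 / r i))\<^sup>2 \<le> (ln ^^ n) (1 / r i)"
    by (intro exI[of _ "Suc n"]) simp
qed

lemma convex_subring_F: "convex_subring U (F_ring U (star_class U r))"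
  unfolding F_ring_def star_map_star_class
proof (rule convex_subring_less)
  fix n :: nat assume n: "n \<ge> 1"
  \<comment> \<open>The witness is \<open>2 * n\<close>: with \<open>s\<close> the root of that
    order, the \<open>n\<close>-th root is \<open>s\<close> squared, so the square condition is an
    equality. The doubling condition amounts to \<open>s \<le> 1 / 2\<close>, that is, to the
    \<open>n\<close>-th root being at most 1/4.\<close>
  have "\<forall>\<^sub>F i in U. r i < (1 / 4) ^ n"
    by (rule r_less) simp
  with r_pos have "\<forall>\<^sub>F i in U. 1 < 1 / root n (r i) \<and> 2 * (1 / root (2 * n) (r i)) \<le> 1 / root n (r i)
      \<and> (1 / root (2 * n) (r i))\<^sup>2 \<le> 1 / root n (r i)"
  proof eventually_elim
    case (elim i)
    define s where "s = root (2 * n) (r i)"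
    have s: "s = sqrt (root n (r i))"
      by (simp add: s_def real_root_mult_exp sqrt_def)
    have "0 < root n (r i)"
      using elim n by (intro real_root_gt_zero) auto
    then have s_pos: "0 < s" and root: "root n (r i) = s\<^sup>2"
      by (simp_all add: s)
    have "root n (r i) < root n ((1 / 4) ^ n)"
      using elim n by (intro real_root_less_mono) auto
    also have "\<dots> = (1 / 2)\<^sup>2"
      using n by (simp add: real_root_power_cancel power2_eq_square)
    finally have "s < 1 / 2"
      unfolding root by (rule power_less_imp_less_base) simp
    moreover from this have "s\<^sup>2 < 1"
      using s_pos by (simp add: power_less_one_iff abs_square_less_1)
    ultimately show ?case
      unfolding s_def[symmetric] root using s_pos
      by (simp add: field_simps power2_eq_square)
  qed
  with n show "\<exists>m\<ge>1. \<forall>\<^sub>F i in U. 1 < 1 / root n (r i) \<and> 2 * (1 / root m (r i)) \<le> 1 / root n (r i)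
      \<and> (1 / root m (r i))\<^sup>2 \<le> 1 / root n (r i)"
    by (intro exI[of _ "2 * n"]) simp
qed

lemma convex_subring_M: "convex_subring U (M_ring U (star_class U r))"
  unfolding M_ring_def star_map_star_class
proof (rule convex_subring_le)
  have eq: "r i powi (- int n) = (1 / r i) ^ n" for i n
    by (simp add: power_int_minus power_one_over inverse_eq_divide)
  show "\<forall>\<^sub>F i in U. 1 \<le> r i powi (- int 1)"
    using inverse_r_greater[of 1] unfolding eq by eventually_elim simp
  fix m n :: nat
  \<comment> \<open>The exponent \<open>m + n\<close> is enough for the product; the additional
    factor \<open>1 / r i\<close>, larger than 2, absorbs the two summands.\<close>
  have "\<forall>\<^sub>F i in U. (1 / r i) ^ m + (1 / r i) ^ n \<le> (1 / r i) ^ Suc (m + n) \<and>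
      (1 / r i) ^ m * (1 / r i) ^ n \<le> (1 / r i) ^ Suc (m + n)"
    using inverse_r_greater[of 2]
  proof eventually_elim
    case (elim i)
    define t where "t = 1 / r i"
    have t: "2 < t"
      using elim by (simp add: t_def)
    have "t ^ m \<le> t ^ (m + n)" "t ^ n \<le> t ^ (m + n)"
      using t by (intro power_increasing; simp)+
    moreover have "2 * t ^ (m + n) \<le> t ^ Suc (m + n)"
      using t by simp
    moreover have "0 \<le> t ^ (m + n)"
      using t by simp
    ultimately show ?case
      unfolding t_def[symmetric] power_add[symmetric] by linarith
  qed
  then show "\<exists>k\<ge>1. \<forall>\<^sub>F i in U. r i powi (- int m) + r i powi (- int n) \<le> r i powi (- int k)
      \<and> r i powi (- int m) * r i powi (- int n) \<le> r i powi (- int k)"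
    unfolding eq by (intro exI[of _ "Suc (m + n)"]) simp
qed

lemma convex_subring_E: "convex_subring U (E_ring U (star_class U r))"
  unfolding E_ring_def star_map_star_class star_map_funpow_star_class
proof (rule convex_subring_le)
  have mono: "(exp ^^ m) x \<le> (exp ^^ (m + n)) x" for m n and x :: real
  proof (induction n)
    case (Suc n)
    have "(exp ^^ (m + n)) x \<le> exp ((exp ^^ (m + n)) x)"
      using exp_ge_add_one_self[of "(exp ^^ (m + n)) x"] by linarith
    with Suc show ?case
      by simp
  qed simp
  show "\<forall>\<^sub>F i in U. 1 \<le> (exp ^^ 1) (1 / r i)"
    using inverse_r_greater[of 0] by eventually_elim simp
  fix m n :: nat
  \<comment> \<open>Both iterates lie below the iterate of order \<open>m + n\<close>, called
    \<open>c\<close> below. Sum and product are then at most \<open>2 * c\<close> and the square of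
    \<open>c\<close>, and one more exponential dominates both.\<close>
  have "\<forall>\<^sub>F i in U. (exp ^^ m) (1 / r i) + (exp ^^ n) (1 / r i) \<le> (exp ^^ Suc (m + n)) (1 / r i) \<and>
      (exp ^^ m) (1 / r i) * (exp ^^ n) (1 / r i) \<le> (exp ^^ Suc (m + n)) (1 / r i)"
    using inverse_r_greater[of 0]
  proof eventually_elim
    case (elim i)
    define a b c where "a = (exp ^^ m) (1 / r i)" and "b = (exp ^^ n) (1 / r i)"
      and "c = (exp ^^ (m + n)) (1 / r i)"
    have "1 / r i \<le> a" "1 / r i \<le> b" "a \<le> c" "b \<le> c"
      using mono[of 0 "1 / r i" m] mono[of 0 "1 / r i" n] mono[of m "1 / r i" n]
        mono[of n "1 / r i" m]
      by (simp_all add: a_def b_def c_def add.commute)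
    then have ge: "0 < a" "0 < b" "a \<le> c" "b \<le> c"
      using elim by linarith+
    then have "a + b \<le> 2 * c" "a * b \<le> c\<^sup>2"
      unfolding power2_eq_square by (linarith, intro mult_mono) auto
    then have "a + b \<le> exp c" "a * b \<le> exp c"
      using exp_ge_double_square[of c] ge by linarith+
    then show ?case
      by (simp add: a_def b_def c_def)
  qed
  then show "\<exists>k\<ge>1. \<forall>\<^sub>F i in U. (exp ^^ m) (1 / r i) + (exp ^^ n) (1 / r i) \<le> (exp ^^ k) (1 / r i)
      \<and> (exp ^^ m) (1 / r i) * (exp ^^ n) (1 / r i) \<le> (exp ^^ k) (1 / r i)"
    by (intro exI[of _ "Suc (m + n)"]) simp
qed

end

theorem theorem17p2:
  fixes U :: "'i filter" and \<kappa> :: "'k rel"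
  assumes "ultrafilter U"
    and "Card_order \<kappa>" and "infinite (Field \<kappa>)"
    and "saturated \<kappa> U"
  shows "(\<forall>M. convex_subring U M \<longrightarrow> asymptotic_field_complete \<kappa> U M) \<and>
    (\<forall>\<rho>. pos_infinitesimal U \<rho> \<longrightarrow>
      (\<forall>M \<in> {L_ring U \<rho>, F_ring U \<rho>, M_ring U \<rho>, E_ring U \<rho>}.
        asymptotic_field_complete \<kappa> U M \<and> real_part_complete \<kappa> U M))"
proof (intro conjI allI impI ballI)
  interpret ultra U
    using assms(1) by (rule ultra.intro)
  have complete: "asymptotic_field_complete \<kappa> U M \<and> real_part_complete \<kappa> U M"
    if "convex_subring U M" for M
  proof -
    interpret convex_ultra U M
      using that by unfold_locales
    show ?thesis
      using assms(4) by (intro conjI asymptotic_field_complete real_part_complete)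
  qed
  show "asymptotic_field_complete \<kappa> U M" if "convex_subring U M" for M
    using complete[OF that] ..
  fix \<rho> M
  assume rho: "pos_infinitesimal U \<rho>" and M: "M \<in> {L_ring U \<rho>, F_ring U \<rho>, M_ring U \<rho>, E_ring U \<rho>}"
  obtain r where r: "\<rho> = star_class U r"
    using rho by (auto simp: pos_infinitesimal_def HR_def ultrapower_def)
  interpret infinitesimal_ultra U r
    using rho unfolding r by unfold_locales
  have "convex_subring U M"
    using M convex_subring_L convex_subring_F convex_subring_M convex_subring_E by (auto simp: r)
  from complete[OF this] show "asymptotic_field_complete \<kappa> U M" "real_part_complete \<kappa> U M"
    by blast+
qed

end
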